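(* Let $X$ be a compact metric space, let $f\colon X\to X$ be a continuous map, and let $x\in X$ be a shadowable point for $f$ (i.e. $x\in Sh(f)$). Then the following conditions are equivalent: (a) $x\in USC(\omega_f)$, i.e. the set-valued map $\omega_f$ is upper semicontinuous at $x$; (b) $\omega_f(x)=\Omega_f(x)$.
   Context: $(X,d)$ is a compact metric space, $f\colon X\to X$ is continuous, and $\mathcal{K}(X)$ is the set of non-empty closed subsets of $X$. $\omega_f(x)$ is the set of $y\in X$ such that $\lim_{j\to\infty}f^{i_j}(x)=y$ for some $0\le i_1<i_2<\cdots$; $\omega_f$ is regarded as a map $X\to\mathcal{K}(X)$. $\Omega_f(x)$ is the set of $y\in X$ for which there are $x_j\in X$, $j\ge1$, and $0\le i_1<i_2<\cdots$ with $\lim_{j\to\infty}x_j=x$ and $\lim_{j\to\infty}f^{i_j}(x_j)=y$. A map $\phi\colon X\to\mathcal{K}(X)$ is upper semicontinuous at $x$ if for every open $U\subset X$ with $\phi(x)\subset U$ there is $\delta>0$ such that $d(x,y)\le\delta$ implies $\phi(y)\subset U$ for all $y\in X$. $USC(\phi)$ is the set of upper semicontinuity points of $\phi$. For $\delta>0$, a sequence $(x_i)_{i\ge0}$ in $X$ is a $\delta$-pseudo orbit of $f$ if $\sup_{i\ge0}d(f(x_i),x_{i+1})\le\delta$; it is $\epsilon$-shadowed by $y\in X$ if $\sup_{i\ge0}d(x_i,f^i(y))\le\epsilon$. A point $x\in X$ is shadowable for $f$ if for every $\epsilon>0$ there is $\delta>0$ such that every $\delta$-pseudo orbit $(x_i)_{i\ge0}$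 of $f$ with $x_0=x$ is $\epsilon$-shadowed by some $y\in X$. $Sh(f)$ is the set of shadowable points. *)

theory Defs
  imports "HOL-Analysis.Analysis"
begin

text \<open>The compact metric space is a carrier set \<open>X\<close> in a metric type, with \<open>f\<close> mapping \<open>X\<close>
  into itself. Sequences indexed by \<open>j \<ge> 1\<close> are indexed by all of \<open>nat\<close>, starting at 0.\<close>

definition closed_hyperspace :: "'a::metric_space set \<Rightarrow> 'a set set" where
  "closed_hyperspace X = {A. A \<noteq> {} \<and> closedin (top_of_set X) A}"

definition omega_limit :: "'a::metric_space set \<Rightarrow> ('a \<Rightarrow> 'a) \<Rightarrow> 'a \<Rightarrow> 'a set" where
  "omega_limit X f x =
     {y \<in> X. \<exists>i :: nat \<Rightarrow> nat. strict_mono i \<and> (\<lambda>j. (f ^^ i j) x) \<longlonglongrightarrow> y}"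

definition Omega_limit :: "'a::metric_space set \<Rightarrow> ('a \<Rightarrow> 'a) \<Rightarrow> 'a \<Rightarrow> 'a set" where
  "Omega_limit X f x =
     {y \<in> X. \<exists>(\<xi> :: nat \<Rightarrow> 'a) (i :: nat \<Rightarrow> nat).
        range \<xi> \<subseteq> X \<and> strict_mono i \<and> \<xi> \<longlonglongrightarrow> x \<and> (\<lambda>j. (f ^^ i j) (\<xi> j)) \<longlonglongrightarrow> y}"

definition usc_at :: "'a::metric_space set \<Rightarrow> ('a \<Rightarrow> 'a set) \<Rightarrow> 'a \<Rightarrow> bool" where
  "usc_at X \<phi> x \<longleftrightarrow>
     (\<forall>U. openin (top_of_set X) U \<and> \<phi> x \<subseteq> U \<longrightarrow>
        (\<exists>\<delta>>0. \<forall>y\<in>X. dist x y \<le> \<delta> \<longrightarrow> \<phi> y \<subseteq> U))"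

definition USC :: "'a::metric_space set \<Rightarrow> ('a \<Rightarrow> 'a set) \<Rightarrow> 'a set" where
  "USC X \<phi> = {x \<in> X. usc_at X \<phi> x}"

text \<open>The bounds \<open>sup\<^sub>i d(\<dots>) \<le> \<delta>\<close> are stated pointwise, since \<open>Sup\<close> on \<open>real\<close> is unspecified for
  unbounded sets.\<close>

definition pseudo_orbit ::
    "'a::metric_space set \<Rightarrow> ('a \<Rightarrow> 'a) \<Rightarrow> real \<Rightarrow> (nat \<Rightarrow> 'a) \<Rightarrow> bool" where
  "pseudo_orbit X f \<delta> \<xi> \<longleftrightarrow> range \<xi> \<subseteq> X \<and> (\<forall>i. dist (f (\<xi> i)) (\<xi> (Suc i)) \<le> \<delta>)"

definition shadowed_by ::
    "('a::metric_space \<Rightarrow> 'a) \<Rightarrow> real \<Rightarrow> (nat \<Rightarrow> 'a) \<Rightarrow> 'a \<Rightarrow> bool" where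
  "shadowed_by f \<epsilon> \<xi> y \<longleftrightarrow> (\<forall>i. dist (\<xi> i) ((f ^^ i) y) \<le> \<epsilon>)"

definition shadowable :: "'a::metric_space set \<Rightarrow> ('a \<Rightarrow> 'a) \<Rightarrow> 'a \<Rightarrow> bool" where
  "shadowable X f x \<longleftrightarrow>
     (\<forall>\<epsilon>>0. \<exists>\<delta>>0. \<forall>\<xi>. pseudo_orbit X f \<delta> \<xi> \<and> \<xi> 0 = x \<longrightarrow> (\<exists>y\<in>X. shadowed_by f \<epsilon> \<xi> y))"

definition Sh :: "'a::metric_space set \<Rightarrow> ('a \<Rightarrow> 'a) \<Rightarrow> 'a set" where
  "Sh X f = {x \<in> X. shadowable X f x}"

lemma funpow_in_carrier: "f ` X \<subseteq> X \<Longrightarrow> x \<in> X \<Longrightarrow> (f ^^ n) x \<in> X"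
  by (induction n) auto

lemma ex_strict_mono_tendsto_iff:
  fixes u :: "nat \<Rightarrow> 'a::metric_space"
  shows "(\<exists>i :: nat \<Rightarrow> nat. strict_mono i \<and> (\<lambda>j. u (i j)) \<longlonglongrightarrow> y) \<longleftrightarrow>
         (\<forall>e>0. \<forall>n. \<exists>m\<ge>n. dist (u m) y < e)"
proof (intro iffI allI impI)
  fix e :: real and n
  assume "\<exists>i :: nat \<Rightarrow> nat. strict_mono i \<and> (\<lambda>j. u (i j)) \<longlonglongrightarrow> y" and "e > 0"
  then obtain i :: "nat \<Rightarrow> nat" and N where i: "strict_mono i"
    and N: "\<And>j. j \<ge> N \<Longrightarrow> dist (u (i j)) y < e"
    unfolding lim_sequentially by blast
  have "i (max n N) \<ge> n"
    using seq_suble[OF i, of "max n N"] by simp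
  then show "\<exists>m\<ge>n. dist (u m) y < e"
    using N[of "max n N"] by auto
next
  assume *: "\<forall>e>0. \<forall>n. \<exists>m\<ge>n. dist (u m) y < e"
  define s where "s = (\<lambda>n k. SOME m. m > k \<and> dist (u m) y < inverse (real (Suc n)))"
  have s: "s n k > k \<and> dist (u (s n k)) y < inverse (real (Suc n))" for n k
  proof -
    obtain m where "m \<ge> Suc k" "dist (u m) y < inverse (real (Suc n))"
      using *[rule_format, of "inverse (real (Suc n))" "Suc k"] by auto
    then have "m > k \<and> dist (u m) y < inverse (real (Suc n))"
      by simp
    then show ?thesis
      unfolding s_def by (rule someI)
  qed
  define i where "i = rec_nat (s 0 0) (\<lambda>n r. s (Suc n) r)"
  have "strict_mono i"
    unfolding strict_mono_Suc_iff by (simp add: i_def s)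
  moreover have "dist (u (i j)) y \<le> inverse (real (Suc j))" for j
    by (cases j) (simp_all only: i_def nat.rec s less_imp_le)
  then have "(\<lambda>j. dist (u (i j)) y) \<longlonglongrightarrow> 0"
    by (intro tendsto_sandwich[OF _ _ tendsto_const LIMSEQ_inverse_real_of_nat]
        always_eventually allI) simp_all
  then have "(\<lambda>j. u (i j)) \<longlonglongrightarrow> y"
    by (rule iffD2[OF tendsto_dist_iff])
  ultimately show "\<exists>i :: nat \<Rightarrow> nat. strict_mono i \<and> (\<lambda>j. u (i j)) \<longlonglongrightarrow> y"
    by blast
qed

lemma omega_limit_in_closed_hyperspace:
  assumes "compact X" and "f ` X \<subseteq> X" and "x \<in> X"
  shows "omega_limit X f x \<in> closed_hyperspace X"
proof -
  have "\<forall>n. (f ^^ n) x \<in> X"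
    using funpow_in_carrier[OF assms(2,3)] by simp
  then obtain l r where "l \<in> X" "strict_mono (r :: nat \<Rightarrow> nat)" "((\<lambda>n. (f ^^ n) x) \<circ> r) \<longlonglongrightarrow> l"
    by (rule seq_compactE[OF assms(1)[unfolded compact_eq_seq_compact_metric]])
  then have "omega_limit X f x \<noteq> {}"
    unfolding omega_limit_def by (auto simp: comp_def)
  moreover have eq: "omega_limit X f x = {y \<in> X. \<forall>e>0. \<forall>n. \<exists>m\<ge>n. dist ((f ^^ m) x) y < e}"
    unfolding omega_limit_def ex_strict_mono_tendsto_iff[of "\<lambda>n. (f ^^ n) x"] ..
  have "closed (omega_limit X f x)"
    unfolding closed_sequential_limits
  proof (intro allI impI, elim conjE)
    fix \<eta> l
    assume \<eta>: "\<forall>n. \<eta> n \<in> omega_limit X f x" and lim: "\<eta> \<longlonglongrightarrow> l"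
    have "l \<in> X"
      using \<eta> lim compact_imp_closed[OF assms(1)] closed_sequentially[of X \<eta> l] unfolding eq by blast
    moreover have "\<exists>m\<ge>n. dist ((f ^^ m) x) l < e" if "e > 0" for e n
    proof -
      obtain k where k: "dist (\<eta> k) l < e / 2"
        using lim \<open>e > 0\<close> metric_LIMSEQ_D[of \<eta> l "e / 2"] by auto
      obtain m where "m \<ge> n" "dist ((f ^^ m) x) (\<eta> k) < e / 2"
        using \<eta>[rule_format, of k, unfolded eq] \<open>e > 0\<close> half_gt_zero by blast
      then show ?thesis
        using k dist_triangle_half_r[of "\<eta> k" "(f ^^ m) x" e l] by (auto simp: dist_commute)
    qed
    ultimately show "l \<in> omega_limit X f x"
      unfolding eq by blast
  qed
  moreover have "omega_limit X f x \<subseteq> X"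
    unfolding omega_limit_def by blast
  ultimately show ?thesis
    unfolding closed_hyperspace_def by (simp add: closed_subset)
qed

end

theory Submission
  imports Defs
begin

text \<open>If \<open>\<omega>(x) = \<Omega>(x)\<close>, limits of points of \<open>\<omega>(y\<^sub>n)\<close> with \<open>y\<^sub>n \<longrightarrow> x\<close> lie in \<open>\<Omega>(x)\<close>, and
  compactness gives upper semicontinuity. Conversely, let \<open>y \<in> \<Omega>(x)\<close>. An orbit starting near \<open>x\<close>
  and passing near \<open>y\<close> comes back close to some \<open>w \<in> \<omega>(x)\<close> by upper semicontinuity. The orbit of
  \<open>x\<close> also visits \<open>w\<close> at a late time \<open>n\<close>, and an orbit starting very near \<open>x\<close> that
  reaches \<open>y\<close> only after time \<open>n\<close> leads from \<open>w\<close> back to \<open>y\<close>. So there are pseudo orbits from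
  \<open>x\<close> visiting \<open>y\<close> infinitely often; a shadowing point \<open>z\<close> is near \<open>x\<close> and \<open>\<omega>(z)\<close> comes near \<open>y\<close>,
  and by upper semicontinuity so does \<open>\<omega>(x)\<close>, which is closed.\<close>

section \<open>Approximation criteria for both limit sets\<close>

lemma omega_limit_iff:
  "y \<in> omega_limit X f x \<longleftrightarrow> y \<in> X \<and> (\<forall>e>0. \<forall>n. \<exists>m\<ge>n. dist ((f ^^ m) x) y < e)"
  unfolding omega_limit_def mem_Collect_eq ex_strict_mono_tendsto_iff[of "\<lambda>n. (f ^^ n) x"] ..

text \<open>This removes the sequences. From right to left, dependent choice picks pairs of a base
  point and a time with errors below \<open>inverse (real (Suc n))\<close>, each time later than the
  previous one, so that the times are strictly increasing.\<close>

lemma Omega_limit_iff: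
  "y \<in> Omega_limit X f x \<longleftrightarrow>
     y \<in> X \<and> (\<forall>e>0. \<forall>n. \<exists>a\<in>X. \<exists>m\<ge>n. dist a x < e \<and> dist ((f ^^ m) a) y < e)"
proof (intro iffI conjI allI impI)
  assume "y \<in> Omega_limit X f x"
  then obtain \<xi> i where y: "y \<in> X" and \<xi>: "range \<xi> \<subseteq> X" "strict_mono (i :: nat \<Rightarrow> nat)"
      "\<xi> \<longlonglongrightarrow> x" "(\<lambda>j. (f ^^ i j) (\<xi> j)) \<longlonglongrightarrow> y"
    unfolding Omega_limit_def by blast
  show "y \<in> X" by fact
  fix e :: real and n :: nat
  assume "e > 0"
  obtain N where N: "\<And>j. j \<ge> N \<Longrightarrow> dist (\<xi> j) x < e"
    using metric_LIMSEQ_D[OF \<xi>(3) \<open>e > 0\<close>] by blast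
  obtain M where M: "\<And>j. j \<ge> M \<Longrightarrow> dist ((f ^^ i j) (\<xi> j)) y < e"
    using metric_LIMSEQ_D[OF \<xi>(4) \<open>e > 0\<close>] by blast
  define j where "j = Max {n, N, M}"
  have "j \<ge> n" "j \<ge> N" "j \<ge> M"
    by (simp_all add: j_def)
  moreover have "i j \<ge> j"
    by (rule seq_suble[OF \<xi>(2)])
  ultimately show "\<exists>a\<in>X. \<exists>m\<ge>n. dist a x < e \<and> dist ((f ^^ m) a) y < e"
    using N M \<xi>(1) by (meson le_trans rangeI subsetD)
next
  assume *: "y \<in> X \<and> (\<forall>e>0. \<forall>n. \<exists>a\<in>X. \<exists>m\<ge>n. dist a x < e \<and> dist ((f ^^ m) a) y < e)"
  define good where "good = (\<lambda>n (a, m). a \<in> X \<and> dist a x < inverse (real (Suc n))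
    \<and> dist ((f ^^ m) a) y < inverse (real (Suc n)))"
  have ex: "\<exists>p. good n p \<and> snd p > k" for n k
  proof -
    obtain a m where "a \<in> X" "m \<ge> Suc k" "dist a x < inverse (real (Suc n))"
      "dist ((f ^^ m) a) y < inverse (real (Suc n))"
      using *[THEN conjunct2, rule_format, of "inverse (real (Suc n))" "Suc k"] by auto
    then show ?thesis
      by (intro exI[of _ "(a, m)"]) (simp add: good_def)
  qed
  obtain p where p: "\<And>n. good n (p n)" "\<And>n. snd (p n) < snd (p (Suc n))"
    using dependent_nat_choice[of good "\<lambda>_ p q. snd p < snd q"] ex by meson
  define \<xi> i where "\<xi> = fst \<circ> p" and "i = snd \<circ> p"
  have \<xi>: "\<xi> n \<in> X" "dist (\<xi> n) x \<le> inverse (real (Suc n))"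
    "dist ((f ^^ i n) (\<xi> n)) y \<le> inverse (real (Suc n))" for n
    using p(1)[of n] by (auto simp: good_def \<xi>_def i_def split: prod.splits)
  have lim: "u \<longlonglongrightarrow> l" if "\<And>n. dist (u n) l \<le> inverse (real (Suc n))" for u and l :: 'a
  proof -
    have "(\<lambda>n. dist (u n) l) \<longlonglongrightarrow> 0"
      by (intro tendsto_sandwich[OF _ _ tendsto_const LIMSEQ_inverse_real_of_nat]
          always_eventually allI that) simp_all
    then show ?thesis
      by (rule iffD2[OF tendsto_dist_iff])
  qed
  have "strict_mono i"
    unfolding strict_mono_Suc_iff by (simp add: i_def p(2))
  moreover have "\<xi> \<longlonglongrightarrow> x" "(\<lambda>n. (f ^^ i n) (\<xi> n)) \<longlonglongrightarrow> y"
    by (intro lim \<xi>)+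
  ultimately show "y \<in> Omega_limit X f x"
    unfolding Omega_limit_def using * \<xi>(1) by blast
qed

text \<open>The point \<open>x\<close> itself serves as the nearby base point.\<close>

lemma omega_limit_subset_Omega_limit:
  assumes "x \<in> X"
  shows "omega_limit X f x \<subseteq> Omega_limit X f x"
proof
  fix y
  assume "y \<in> omega_limit X f x"
  then show "y \<in> Omega_limit X f x"
    using assms unfolding omega_limit_iff Omega_limit_iff by (metis dist_self)
qed

section \<open>Compactness and upper semicontinuity\<close>

text \<open>The visits lie in a closed ball intersected with \<open>X\<close>, which is compact, so
  a limit of a subsequence keeps the bound \<open>e\<close>; the visits occur arbitrarily late,
  hence this limit belongs to the limit set.\<close>

lemma omega_limit_meets_cball:
  assumes "compact X" "f ` X \<subseteq> X" "z \<in> X"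
    and freq: "\<And>n. \<exists>m\<ge>n. dist y ((f ^^ m) z) \<le> e"
  obtains v where "v \<in> omega_limit X f z" "dist y v \<le> e"
proof -
  obtain g where g: "\<And>n. g n \<ge> n" "\<And>n. dist y ((f ^^ g n) z) \<le> e"
    using freq by metis
  have "compact (X \<inter> cball y e)"
    using assms(1) by (simp add: compact_Int_closed)
  moreover have "(f ^^ g n) z \<in> X \<inter> cball y e" for n
    using g funpow_in_carrier[OF assms(2,3)] by simp
  ultimately obtain v r where v: "v \<in> X \<inter> cball y e" "strict_mono (r :: nat \<Rightarrow> nat)"
    "((\<lambda>n. (f ^^ g n) z) \<circ> r) \<longlonglongrightarrow> v"
    by (metis (no_types, lifting) compact_def)
  have "\<exists>m\<ge>n. dist ((f ^^ m) z) v < d" if "d > 0" for d n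
  proof -
    obtain N where N: "\<And>k. k \<ge> N \<Longrightarrow> dist ((f ^^ g (r k)) z) v < d"
      using metric_LIMSEQ_D[OF v(3) \<open>d > 0\<close>] by auto
    have "n \<le> g (r (max n N))"
      using g(1)[of "r (max n N)"] seq_suble[OF v(2), of "max n N"] by linarith
    then show ?thesis
      using N[of "max n N"] by auto
  qed
  then have "v \<in> omega_limit X f z"
    using v(1) by (simp add: omega_limit_iff)
  then show thesis
    using v(1) that by simp
qed

text \<open>Upper semicontinuity is applied to the \<open>e\<close>-neighbourhood of
  \<open>omega_limit X f x\<close> in \<open>X\<close>, which turns it into a distance
  estimate.\<close>

lemma usc_at_omega_limitD:
  assumes "usc_at X (omega_limit X f) x" "e > 0"
  obtains d where "d > 0"
    "\<And>z v. z \<in> X \<Longrightarrow> dist x z \<le> d \<Longrightarrow> v \<in> omega_limit X f z \<Longrightarrow> \<exists>w\<in>omega_limit X f x. dist v w < e"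
proof -
  define U where "U = X \<inter> (\<Union>w\<in>omega_limit X f x. ball w e)"
  have "openin (top_of_set X) U"
    unfolding U_def by (intro openin_open_Int open_UN ballI open_ball)
  moreover have "omega_limit X f x \<subseteq> U"
    using \<open>e > 0\<close> by (auto simp: U_def omega_limit_iff)
  ultimately obtain d where "d > 0" "\<forall>z\<in>X. dist x z \<le> d \<longrightarrow> omega_limit X f z \<subseteq> U"
    using assms(1) unfolding usc_at_def by blast
  then show thesis
    by (intro that[of d]) (force simp: U_def dist_commute)+
qed

text \<open>If some \<open>U\<close> violates upper semicontinuity, there are \<open>y n\<close>
  tending to \<open>x\<close> and \<open>z n\<close> outside \<open>U\<close> in their limit sets.
  The \<open>z n\<close> accumulate at some \<open>l\<close> in the compact set
  \<open>X - U\<close>, and late iterates of \<open>y n\<close> close to \<open>z n\<close> place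
  \<open>l\<close> in \<open>Omega_limit X f x\<close>, which lies inside \<open>U\<close>.\<close>

lemma usc_at_omega_limit_if_Omega_limit_subset:
  assumes "compact X" and sub: "Omega_limit X f x \<subseteq> omega_limit X f x"
  shows "usc_at X (omega_limit X f) x"
  unfolding usc_at_def
proof (intro allI impI, elim conjE, rule ccontr)
  fix U
  assume U: "openin (top_of_set X) U" "omega_limit X f x \<subseteq> U"
    and no: "\<not> (\<exists>\<delta>>0. \<forall>y\<in>X. dist x y \<le> \<delta> \<longrightarrow> omega_limit X f y \<subseteq> U)"
  have "\<exists>y z. y \<in> X \<and> dist x y \<le> inverse (real (Suc n)) \<and> z \<in> omega_limit X f y - U" for n
  proof -
    have "inverse (real (Suc n)) > 0"
      by simp
    then show ?thesis
      using no by blast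
  qed
  then obtain y z where y: "\<And>n. y n \<in> X" "\<And>n. dist x (y n) \<le> inverse (real (Suc n))"
    and z: "\<And>n. z n \<in> omega_limit X f (y n) - U"
    by metis
  have "compact (X - U)"
    using closedin_compact[OF assms(1) closedin_diff[OF closedin_subtopology_refl[THEN iffD2] U(1)]]
    by simp
  moreover have "z n \<in> X - U" for n
    using z[of n] by (simp add: omega_limit_iff)
  ultimately obtain l r where l: "l \<in> X - U" and r: "strict_mono (r :: nat \<Rightarrow> nat)" "(z \<circ> r) \<longlonglongrightarrow> l"
    by (metis (no_types, lifting) compact_def)
  have "\<exists>a\<in>X. \<exists>m\<ge>n. dist a x < e \<and> dist ((f ^^ m) a) l < e" if "e > 0" for e n
  proof -
    obtain N where N: "\<And>k. k \<ge> N \<Longrightarrow> dist (z (r k)) l < e / 2"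
      using metric_LIMSEQ_D[OF r(2), of "e / 2"] \<open>e > 0\<close> by auto
    obtain M where M: "inverse (real (Suc M)) < e"
      using reals_Archimedean[OF \<open>e > 0\<close>] by blast
    \<comment> \<open>One index late enough both for \<open>z k\<close> to be near \<open>l\<close>
      and for \<open>y k\<close> to be near \<open>x\<close>.\<close>
    define k where "k = r (max N M)"
    have "M \<le> k"
      using seq_suble[OF r(1), of "max N M"] by (simp add: k_def)
    then have "inverse (real (Suc k)) \<le> inverse (real (Suc M))"
      by (intro le_imp_inverse_le) auto
    then have "dist (y k) x < e"
      using y(2)[of k] M dist_commute[of x "y k"] by linarith
    moreover have "\<forall>d>0. \<exists>m\<ge>n. dist ((f ^^ m) (y k)) (z k) < d"
      using z[of k] by (simp add: omega_limit_iff)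
    then obtain m where "m \<ge> n" "dist ((f ^^ m) (y k)) (z k) < e / 2"
      using half_gt_zero[OF \<open>e > 0\<close>] by blast
    then have "m \<ge> n" "dist ((f ^^ m) (y k)) l < e"
      using N[of "max N M"] dist_triangle[of "(f ^^ m) (y k)" l "z k"] by (simp_all add: k_def)
    ultimately show ?thesis
      using y(1) by blast
  qed
  then have "l \<in> Omega_limit X f x"
    using l by (simp add: Omega_limit_iff)
  then show False
    using sub U(2) l by blast
qed

section \<open>Finite chains and loops\<close>

text \<open>One step of a \<open>\<delta>\<close>-pseudo orbit as a relation, so that joining finite
  chains is transitivity of its closure.\<close>

definition chain_step :: "'a::metric_space set \<Rightarrow> ('a \<Rightarrow> 'a) \<Rightarrow> real \<Rightarrow> 'a \<Rightarrow> 'a \<Rightarrow> bool" where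
  "chain_step X f \<delta> u v \<longleftrightarrow> v \<in> X \<and> dist (f u) v \<le> \<delta>"

lemma rtranclp_chain_step_funpow:
  assumes "f ` X \<subseteq> X" "a \<in> X" "\<delta> \<ge> 0" "m \<le> n"
  shows "(chain_step X f \<delta>)\<^sup>*\<^sup>* ((f ^^ m) a) ((f ^^ n) a)"
  using assms(4)
proof (induction n rule: dec_induct)
  case (step n)
  have "chain_step X f \<delta> ((f ^^ n) a) ((f ^^ Suc n) a)"
    using funpow_in_carrier[OF assms(1,2), of "Suc n"] assms(3) by (simp add: chain_step_def)
  then show ?case
    using step.IH by (rule rtranclp.rtrancl_into_rtrancl[rotated])
qed simp

text \<open>The chain jumps from \<open>u\<close> onto the orbit of \<open>a\<close>, follows it
  exactly, and leaves it for \<open>v\<close> in the last step. \<open>Suc m < n\<close> keeps the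
  two jumps in different steps, so their errors do not add up.\<close>

lemma tranclp_chain_step_along_orbit:
  assumes "f ` X \<subseteq> X" "a \<in> X" "v \<in> X" "\<delta> \<ge> 0" "Suc m < n"
    and "dist (f u) (f ((f ^^ m) a)) \<le> \<delta>" "dist ((f ^^ n) a) v \<le> \<delta>"
  shows "(chain_step X f \<delta>)\<^sup>+\<^sup>+ u v"
proof -
  obtain k where k: "n = Suc k" "Suc m \<le> k"
    using assms(5) by (cases n) auto
  have "chain_step X f \<delta> u ((f ^^ Suc m) a)"
    using funpow_in_carrier[OF assms(1,2), of "Suc m"] assms(6) by (simp add: chain_step_def)
  moreover have "(chain_step X f \<delta>)\<^sup>*\<^sup>* ((f ^^ Suc m) a) ((f ^^ k) a)"
    by (rule rtranclp_chain_step_funpow[OF assms(1,2,4) k(2)])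
  moreover have "chain_step X f \<delta> ((f ^^ k) a) v"
    using assms(3,7) k(1) by (simp add: chain_step_def)
  ultimately show ?thesis
    by (meson converse_rtranclp_into_rtranclp rtranclp_into_tranclp1)
qed

text \<open>The loop is repeated periodically, and the steps leading from \<open>x\<close> to
  \<open>y\<close> are prepended one at a time.\<close>

lemma infinite_chain_through_loop:
  assumes "R\<^sup>*\<^sup>* x y" "R\<^sup>+\<^sup>+ y y"
  obtains \<xi> :: "nat \<Rightarrow> 'a" where "\<xi> 0 = x" "\<And>i. R (\<xi> i) (\<xi> (Suc i))" "\<And>n. \<exists>m\<ge>n. \<xi> m = y"
proof -
  have "\<exists>\<xi> :: nat \<Rightarrow> 'a. \<xi> 0 = x \<and> (\<forall>i. R (\<xi> i) (\<xi> (Suc i))) \<and> (\<forall>n. \<exists>m\<ge>n. \<xi> m = y)"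
    using assms(1)
  proof (induction rule: converse_rtranclp_induct)
    case base
    obtain n where n: "n > 0" "(R ^^ n) y y"
      using assms(2) by (auto simp: tranclp_power)
    then obtain g where g: "g 0 = y" "g n = y" "\<And>i. i < n \<Longrightarrow> R (g i) (g (Suc i))"
      unfolding relpowp_fun_conv by blast
    \<comment> \<open>At the wrap-around, where \<open>Suc i mod n = 0\<close>, this is the last
      step of the loop, since \<open>g n = y = g 0\<close>.\<close>
    have "R (g (i mod n)) (g (Suc i mod n))" for i
      using g(3)[of "i mod n"] g(1,2) n(1) by (auto simp: mod_Suc)
    moreover have "\<exists>m\<ge>k. g (m mod n) = y" for k
      using g(1) n(1) by (intro exI[of _ "n * k"]) simp
    ultimately show ?case
      using g(1) by (intro exI[of _ "\<lambda>i. g (i mod n)"]) simp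
  next
    case (step u v)
    then obtain \<xi> :: "nat \<Rightarrow> 'a" where \<xi>: "\<xi> 0 = v" "\<And>i. R (\<xi> i) (\<xi> (Suc i))" "\<And>n. \<exists>m\<ge>n. \<xi> m = y"
      by blast
    have "R (case_nat u \<xi> i) (case_nat u \<xi> (Suc i))" for i
      using \<xi>(1,2) step.hyps(1) by (cases i) simp_all
    moreover have "\<exists>m\<ge>n. case_nat u \<xi> m = y" for n
    proof -
      obtain m where "m \<ge> n" "\<xi> m = y"
        using \<xi>(3) by blast
      then show ?thesis
        by (intro exI[of _ "Suc m"]) simp
    qed
    ultimately show ?case
      by (intro exI[of _ "case_nat u \<xi>"]) simp
  qed
  then show thesis
    using that by blast
qed

section \<open>Chains from \<open>x\<close> to \<open>y\<close> and back to \<open>y\<close>\<close>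

lemma Omega_limit_chains:
  assumes X: "compact X" "continuous_on X f" "f ` X \<subseteq> X" "x \<in> X"
    and usc: "usc_at X (omega_limit X f) x"
    and y: "y \<in> Omega_limit X f x" and "\<delta> > 0"
  shows "(chain_step X f \<delta>)\<^sup>+\<^sup>+ x y" and "(chain_step X f \<delta>)\<^sup>+\<^sup>+ y y"
proof -
  have fX: "(f ^^ n) u \<in> X" if "u \<in> X" for u n
    using funpow_in_carrier[OF X(3) that] .
  obtain \<eta> where "\<eta> > 0"
    and \<eta>: "\<And>u v. u \<in> X \<Longrightarrow> v \<in> X \<Longrightarrow> dist u v < \<eta> \<Longrightarrow> dist (f u) (f v) \<le> \<delta>"
    using compact_uniformly_continuous[OF X(2,1)] \<open>\<delta> > 0\<close>
    unfolding uniformly_continuous_on_def by (metis less_imp_le)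
  have yX: "y \<in> X"
    using y by (simp add: Omega_limit_iff)
  \<comment> \<open>Halved so that two errors below \<open>\<rho>\<close> together stay within
    \<open>\<eta>\<close>, for uniform continuity, and within \<open>\<delta>\<close>, for a
    jump.\<close>
  define \<rho> where "\<rho> = min \<eta> \<delta> / 2"
  have \<rho>: "\<rho> > 0" "2 * \<rho> \<le> \<eta>" "2 * \<rho> \<le> \<delta>"
    using \<open>\<eta> > 0\<close> \<open>\<delta> > 0\<close> by (simp_all add: \<rho>_def)
  obtain d where "d > 0"
    and d: "\<And>z v. z \<in> X \<Longrightarrow> dist x z \<le> d \<Longrightarrow> v \<in> omega_limit X f z \<Longrightarrow> \<exists>w\<in>omega_limit X f x. dist v w < \<rho>"
    using usc_at_omega_limitD[OF usc \<rho>(1)] by blast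
  \<comment> \<open>This orbit carries both the chain from \<open>x\<close> to \<open>y\<close> and
    the one from \<open>y\<close> to \<open>w\<close>: the bound \<open>d\<close> lets upper
    semicontinuity act on \<open>a\<close>, the bound \<open>\<rho>\<close> keeps the jumps small.
    \<open>p \<ge> 2\<close> leaves room for two separate jumps.\<close>
  obtain a p where a: "a \<in> X" "p \<ge> 2" "dist a x < min d \<rho>" "dist ((f ^^ p) a) y < min d \<rho>"
    using y \<open>d > 0\<close> \<rho>(1) unfolding Omega_limit_iff by (metis min_less_iff_conj)
  show "(chain_step X f \<delta>)\<^sup>+\<^sup>+ x y"
  proof (rule tranclp_chain_step_along_orbit[OF X(3) a(1) yX])
    show "dist (f x) (f ((f ^^ 0) a)) \<le> \<delta>"
      using \<eta>[OF X(4) a(1)] a(3) \<rho> by (simp add: dist_commute)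
    show "dist ((f ^^ p) a) y \<le> \<delta>"
      using a(4) \<rho> by simp
  qed (use a \<rho> \<open>\<delta> > 0\<close> in auto)

  obtain v where v: "v \<in> omega_limit X f a"
    using omega_limit_in_closed_hyperspace[OF X(1,3) a(1)] by (auto simp: closed_hyperspace_def)
  obtain w where w: "w \<in> omega_limit X f x" "dist v w < \<rho>"
    using d[OF a(1) _ v] a(3) by (auto simp: dist_commute)
  have wX: "w \<in> X"
    using w(1) by (simp add: omega_limit_iff)
  obtain m where m: "m \<ge> p + 2" "dist ((f ^^ m) a) v < \<rho>"
    using v \<rho>(1) unfolding omega_limit_iff by blast
  have "(chain_step X f \<delta>)\<^sup>+\<^sup>+ y w"
  proof (rule tranclp_chain_step_along_orbit[OF X(3) a(1) wX])
    show "dist (f y) (f ((f ^^ p) a)) \<le> \<delta>"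
      using \<eta>[OF yX fX[OF a(1)]] a(4) \<rho> by (simp add: dist_commute)
    show "dist ((f ^^ m) a) w \<le> \<delta>"
      using m(2) w(2) \<rho> dist_triangle[of "(f ^^ m) a" w v] by linarith
  qed (use m \<open>\<delta> > 0\<close> in auto)

  moreover obtain n where n: "dist ((f ^^ n) x) w < \<rho>"
    using w(1) \<rho>(1) unfolding omega_limit_iff by blast
  have "continuous_on X (f ^^ n)"
  proof (induction n)
    case (Suc n)
    have "(f ^^ n) ` X \<subseteq> X"
      using fX by blast
    then show ?case
      using continuous_on_compose[OF Suc continuous_on_subset[OF X(2)]] by simp
  qed simp
  then obtain e where "e > 0" and e: "\<And>b. b \<in> X \<Longrightarrow> dist b x < e \<Longrightarrow> dist ((f ^^ n) b) ((f ^^ n) x) < \<rho>"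
    using X(4) \<rho>(1) unfolding continuous_on_iff by blast
  \<comment> \<open>The radius \<open>e\<close> depends on \<open>n\<close>, hence on
    \<open>w\<close> and on \<open>a\<close>, so a new base point is chosen: its orbit is near
    \<open>w\<close> at time \<open>n\<close> and near \<open>y\<close> at the later time
    \<open>q\<close>.\<close>
  obtain b q where b: "b \<in> X" "q \<ge> n + 2" "dist b x < min e \<rho>" "dist ((f ^^ q) b) y < min e \<rho>"
    using y \<open>e > 0\<close> \<rho>(1) unfolding Omega_limit_iff by (metis min_less_iff_conj)
  have "(chain_step X f \<delta>)\<^sup>+\<^sup>+ w y"
  proof (rule tranclp_chain_step_along_orbit[OF X(3) b(1) yX])
    have "dist ((f ^^ n) b) ((f ^^ n) x) < \<rho>"
      using e b(1,3) by simp
    then have "dist w ((f ^^ n) b) < \<eta>"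
      using n \<rho> dist_triangle[of "(f ^^ n) b" w "(f ^^ n) x"] by (simp add: dist_commute)
    then show "dist (f w) (f ((f ^^ n) b)) \<le> \<delta>"
      using \<eta>[OF wX fX[OF b(1)]] by blast
    show "dist ((f ^^ q) b) y \<le> \<delta>"
      using b(4) \<rho> by simp
  qed (use b \<rho> \<open>\<delta> > 0\<close> in auto)
  ultimately show "(chain_step X f \<delta>)\<^sup>+\<^sup>+ y y"
    by (rule tranclp_trans)
qed

section \<open>Shadowing the recurrent pseudo orbit\<close>

lemma Omega_limit_subset_omega_limit_if_usc_at:
  assumes X: "compact X" "continuous_on X f" "f ` X \<subseteq> X" "x \<in> X"
    and sh: "shadowable X f x" and usc: "usc_at X (omega_limit X f) x"
  shows "Omega_limit X f x \<subseteq> omega_limit X f x"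
proof
  fix y
  assume y: "y \<in> Omega_limit X f x"
  have "\<exists>w\<in>omega_limit X f x. dist w y < e" if "e > 0" for e
  proof -
    obtain d where "d > 0"
      and d: "\<And>z v. z \<in> X \<Longrightarrow> dist x z \<le> d \<Longrightarrow> v \<in> omega_limit X f z \<Longrightarrow> \<exists>w\<in>omega_limit X f x. dist v w < e / 2"
      using usc_at_omega_limitD[OF usc, of "e / 2"] \<open>e > 0\<close> half_gt_zero by blast
    \<comment> \<open>The bound \<open>d\<close> brings the shadowing point \<open>z\<close> into
      the range of upper semicontinuity; the bound \<open>e / 2\<close> leaves the other half of
      \<open>e\<close> for the passage from \<open>v\<close> to \<open>w\<close>.\<close>
    define \<epsilon> where "\<epsilon> = min d (e / 2)"
    have \<epsilon>: "\<epsilon> > 0" "\<epsilon> \<le> d" "\<epsilon> \<le> e / 2"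
      using \<open>d > 0\<close> \<open>e > 0\<close> by (simp_all add: \<epsilon>_def)
    obtain \<delta> where "\<delta> > 0"
      and \<delta>: "\<And>\<xi>. pseudo_orbit X f \<delta> \<xi> \<Longrightarrow> \<xi> 0 = x \<Longrightarrow> \<exists>z\<in>X. shadowed_by f \<epsilon> \<xi> z"
      using sh \<epsilon>(1) unfolding shadowable_def by blast
    note chains = Omega_limit_chains[OF X usc y \<open>\<delta> > 0\<close>]
    obtain \<xi> where \<xi>: "\<xi> 0 = x" "\<And>i. chain_step X f \<delta> (\<xi> i) (\<xi> (Suc i))" "\<And>n. \<exists>m\<ge>n. \<xi> m = y"
      using infinite_chain_through_loop[OF tranclp_into_rtranclp[OF chains(1)] chains(2)] by blast
    have "\<xi> i \<in> X" for i
      using \<xi>(1,2) X(4) by (cases i) (auto simp: chain_step_def)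
    then have "pseudo_orbit X f \<delta> \<xi>"
      using \<xi>(2) by (auto simp: pseudo_orbit_def chain_step_def)
    then obtain z where "z \<in> X" and z: "\<And>i. dist (\<xi> i) ((f ^^ i) z) \<le> \<epsilon>"
      using \<delta> \<xi>(1) unfolding shadowed_by_def by blast
    \<comment> \<open>The pseudo orbit equals \<open>y\<close> at arbitrarily late times, and the
      orbit of \<open>z\<close> is \<open>\<epsilon>\<close>-close to it then.\<close>
    have "\<exists>m\<ge>n. dist y ((f ^^ m) z) \<le> \<epsilon>" for n
      using \<xi>(3)[of n] z by metis
    then obtain v where v: "v \<in> omega_limit X f z" "dist y v \<le> \<epsilon>"
      using omega_limit_meets_cball[OF X(1,3) \<open>z \<in> X\<close>] by blast
    have "dist x z \<le> d"
      using z[of 0] \<xi>(1) \<epsilon>(2) by simp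
    then obtain w where "w \<in> omega_limit X f x" "dist v w < e / 2"
      using d[OF \<open>z \<in> X\<close> _ v(1)] by blast
    moreover have "dist w y < e"
      using calculation(2) v(2) \<epsilon>(3) dist_triangle[of y w v] by (simp add: dist_commute)
    ultimately show ?thesis
      by blast
  qed
  then have "y \<in> closure (omega_limit X f x)"
    unfolding closure_approachable by blast
  moreover have "closed (omega_limit X f x)"
    using omega_limit_in_closed_hyperspace[OF X(1,3,4)] compact_imp_closed[OF X(1)]
    unfolding closed_hyperspace_def by (auto intro: closedin_closed_trans)
  ultimately show "y \<in> omega_limit X f x"
    by simp
qed

theorem theorem2p1:
  fixes X :: "'a::metric_space set" and f :: "'a \<Rightarrow> 'a" and x :: 'a
  assumes "compact X" and "continuous_on X f" and "f ` X \<subseteq> X" and "x \<in> Sh X f"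
  shows "x \<in> USC X (omega_limit X f) \<longleftrightarrow> omega_limit X f x = Omega_limit X f x"
proof -
  have x: "x \<in> X" "shadowable X f x"
    using assms(4) by (simp_all add: Sh_def)
  \<comment> \<open>One inclusion between the limit sets always holds, so their equality amounts to
    the other one.\<close>
  show ?thesis
    using Omega_limit_subset_omega_limit_if_usc_at[OF assms(1-3) x]
      usc_at_omega_limit_if_Omega_limit_subset[OF assms(1)]
      omega_limit_subset_Omega_limit[OF x(1)] x(1)
    unfolding USC_def by blast
qed

end
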